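(* There are $n$-node directed graphs $G$ such that any shortest-paths preserving graph $H$ of $G$ has aspect ratio $2^{\Omega(n)}$.
   Context: The aspect ratio of a graph with positive edge weights $w$ is $\max_e w(e)/\min_e w(e)$. Given a graph $G=(V,E,w)$, a reweighted graph $H=(V,E,w_H)$ on the same vertex and edge set with positive weights $w_H$ is called shortest-paths preserving if for every shortest path $\pi$ in $H$, the sequence of nodes and edges along $\pi$ is also a shortest path in $G$. The bound $2^{\Omega(n)}$ means: there is an absolute constant $c>0$ such that for infinitely many $n$ there is such a graph $G$ for which every shortest-paths preserving $H$ has aspect ratio at least $2^{cn}$. *)

theory Defs
  imports "Graph_Theory.Shortest_Path"
begin

context wf_digraph
begin

definition positive_weights :: "'b weight_fun \<Rightarrow> bool" where
  "positive_weights w \<longleftrightarrow> (\<forall>e \<in> arcs G. 0 < w e)"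

text \<open>A shortest path is a simple path realising the distance from \<open>u\<close> to \<open>v\<close>. It is given by its
  arc sequence together with its endpoints; these determine the node sequence.\<close>

definition shortest_path :: "'b weight_fun \<Rightarrow> 'a \<Rightarrow> 'b awalk \<Rightarrow> 'a \<Rightarrow> bool" where
  "shortest_path w u p v \<longleftrightarrow> apath u p v \<and> ereal (awalk_cost w p) = \<mu> w u v"

text \<open>The reweighted graph \<open>H\<close> has the same vertices and arcs as \<open>G\<close>, so it is represented by its
  weight function \<open>w\<^sub>H\<close> on the arcs of \<open>G\<close>.\<close>

definition shortest_paths_preserving :: "'b weight_fun \<Rightarrow> 'b weight_fun \<Rightarrow> bool" where
  "shortest_paths_preserving w w\<^sub>H \<longleftrightarrow>
     positive_weights w\<^sub>H \<and>
     (\<forall>u p v. shortest_path w\<^sub>H u p v \<longrightarrow> shortest_path w u p v)"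

text \<open>Only meaningful for finite, nonempty \<open>arcs G\<close>.\<close>

definition aspect_ratio :: "'b weight_fun \<Rightarrow> real" where
  "aspect_ratio w = Max (w ` arcs G) / Min (w ` arcs G)"

end

end

theory Submission
  imports Defs
begin

text \<open>In a symmetric graph take a cycle made of a path \<open>P\<close> from \<open>x\<close> to \<open>y\<close>, arcs joining \<open>s\<close> to \<open>x\<close>
  and \<open>t\<close> to \<open>y\<close>, and an arc joining \<open>s\<close> to \<open>t\<close>. If the unique shortest paths from \<open>s\<close> to \<open>y\<close> and
  from \<open>x\<close> to \<open>t\<close> both run along \<open>P\<close>, then adding the two inequalities cancels the joining arcs and
  leaves \<open>P \<le> st\<close> in every shortest-paths preserving reweighting, where the weights of opposite arcs
  are added up. The graph has levels of three vertices \<open>a b c\<close>, and both arcs of the path \<open>a b c\<close> on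
  level \<open>k + 1\<close> play the role of \<open>st\<close> for the path \<open>P = a b c\<close> on level \<open>k\<close>. So the length of this
  path at least doubles from level to level.\<close>

section \<open>Potentials, walk costs and uniqueness of simple paths\<close>

context wf_digraph
begin

lemma potential_telescope:
  assumes "awalk u p v"
  shows "(\<Sum>a\<leftarrow>p. \<phi> (head G a) - \<phi> (tail G a)) = (\<phi> v - \<phi> u :: real)"
  using assms by (induction p arbitrary: u) (auto simp: awalk_simps)

text \<open>Weak duality: the potential differences along a walk telescope, and each is at most the
  weight of its arc.\<close>

lemma awalk_cost_ge_potential:
  assumes "awalk u p v"
    and "\<And>a. a \<in> arcs G \<Longrightarrow> \<phi> (head G a) - \<phi> (tail G a) \<le> w a"
  shows "\<phi> v - \<phi> u \<le> awalk_cost w p"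
  using assms(1)
proof (induction p arbitrary: u)
  case (Cons a p)
  then have "\<phi> v - \<phi> (head G a) \<le> awalk_cost w p" and "a \<in> arcs G" "tail G a = u"
    by (auto simp: awalk_simps)
  then show ?case using assms(2)[of a] by simp
qed (simp add: awalk_simps)

text \<open>Complementary slackness: the remaining walk already costs at least its own potential
  difference, so slack on one arc cannot be made up elsewhere.\<close>

lemma tight_awalk_arcs:
  assumes "awalk u p v"
    and "\<And>a. a \<in> arcs G \<Longrightarrow> \<phi> (head G a) - \<phi> (tail G a) \<le> w a"
    and "awalk_cost w p \<le> \<phi> v - \<phi> u"
    and "a \<in> set p"
  shows "\<phi> (head G a) - \<phi> (tail G a) = w a"
  using assms(1,3,4)
proof (induction p arbitrary: u)
  case (Cons b p)
  then have b: "awalk (head G b) p v" "b \<in> arcs G" "tail G b = u"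
    by (auto simp: awalk_simps)
  have "\<phi> v - \<phi> (head G b) \<le> awalk_cost w p"
    using awalk_cost_ge_potential[OF b(1) assms(2)] .
  moreover have "\<phi> (head G b) - \<phi> (tail G b) \<le> w b" using assms(2) b(2) .
  ultimately have "awalk_cost w p \<le> \<phi> v - \<phi> (head G b)" "\<phi> (head G b) - \<phi> (tail G b) = w b"
    using Cons.prems(2) b(3) by auto
  then show ?case using Cons b by auto
qed simp

text \<open>A simple path leaves its start by its first arc only, so \<open>r\<close> must begin
  with the same arc as \<open>p\<close>. Since \<open>r\<close> never returns to \<open>u\<close>,
  its remainder uses only the remaining arcs of \<open>p\<close>, and induction applies.\<close>

lemma apath_subset_eq:
  assumes "apath u p v" "apath u r v" "set r \<subseteq> set p"
  shows "r = p"
  using assms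
proof (induction p arbitrary: u r)
  case Nil
  then show ?case by auto
next
  case (Cons e p)
  have e: "tail G e = u" "apath (head G e) p v" "u \<notin> set (awalk_verts (head G e) p)"
    using Cons.prems(1) by (auto simp: apath_Cons_iff)
  have p: "awalk (head G e) p v" using e(2) by (simp add: apath_def)
  have "u \<noteq> v"
    using apath_nonempty_ends[OF Cons.prems(1)] by simp
  with Cons.prems(2) obtain f r' where r: "r = f # r'"
    by (cases r) (auto simp: apath_Nil_iff)
  have f: "tail G f = u" "apath (head G f) r' v" "u \<notin> set (awalk_verts (head G f) r')"
    using Cons.prems(2) r by (auto simp: apath_Cons_iff)
  have out: "tail G a \<noteq> u" if "a \<in> set p" for a
    using that e(3) awalk_verts_arc1[of a p] by auto
  have fe: "f = e" using Cons.prems(3) r f(1) out by auto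
  have "e \<notin> set r'"
    using f(3) e(1) awalk_verts_arc1[of e r'] by auto
  then have "r' = p" using Cons.IH[OF e(2)] f(2) fe Cons.prems(3) r by auto
  then show ?case using r fe by simp
qed

end

text \<open>Linear programming duality: a potential that is tight exactly on the arcs of \<open>p\<close> certifies
  that \<open>p\<close> is the unique shortest path of \<open>G\<close> between its ends.\<close>

lemma (in fin_digraph) preserved_path_cost_le:
  assumes spp: "shortest_paths_preserving w w\<^sub>H"
    and p: "apath u p v" and q: "awalk u q v"
    and tight: "\<And>a. a \<in> set p \<Longrightarrow> \<phi> (head G a) - \<phi> (tail G a) = w a"
    and slack: "\<And>a. a \<in> arcs G \<Longrightarrow> a \<notin> set p \<Longrightarrow> \<phi> (head G a) - \<phi> (tail G a) < w a"
  shows "awalk_cost w\<^sub>H p \<le> awalk_cost w\<^sub>H q"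
proof -
  have pw: "awalk u p v" using p by (simp add: apath_def)
  have pos: "\<And>a. a \<in> arcs G \<Longrightarrow> 0 \<le> w\<^sub>H a"
    using spp by (auto simp: shortest_paths_preserving_def positive_weights_def less_imp_le)
  \<comment> \<open>Positive weights exclude negative cycles, so some simple path \<open>r\<close>
    attains the distance in \<open>w\<^sub>H\<close>.\<close>
  have "\<not> (\<exists>x c. awalk x c x \<and> x \<in> set (awalk_verts u s) \<and> awalk_cost w\<^sub>H c < 0)" for s
  proof
    assume "\<exists>x c. awalk x c x \<and> x \<in> set (awalk_verts u s) \<and> awalk_cost w\<^sub>H c < 0"
    then obtain x c where "awalk x c x" "awalk_cost w\<^sub>H c < 0" by auto
    then show False using pos_cost_pos_awalk_cost[where c = w\<^sub>H, OF _ pos, of x c x] by simp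
  qed
  with reachable_awalkI[OF pw]
  obtain r where r: "apath u r v" "\<mu> w\<^sub>H u v = awalk_cost w\<^sub>H r"
    using no_neg_cyc_reach_imp_path[of u v w\<^sub>H] by auto
  \<comment> \<open>By preservation \<open>r\<close> is also shortest for \<open>w\<close>, hence
    costs at most as much as \<open>p\<close>, whose cost telescopes to the potential difference.
    Complementary slackness then confines \<open>r\<close> to tight arcs, which are those of
    \<open>p\<close>.\<close>
  then have "shortest_path w u r v"
    using spp by (auto simp: shortest_paths_preserving_def shortest_path_def)
  then have "awalk_cost w r \<le> awalk_cost w p"
    using min_cost_le_walk_cost[OF pw, of w] by (metis ereal_less_eq(3) shortest_path_def)
  also have "awalk_cost w p = (\<Sum>a\<leftarrow>p. \<phi> (head G a) - \<phi> (tail G a))"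
    unfolding awalk_cost_def by (simp add: tight cong: map_cong)
  also have "\<dots> = \<phi> v - \<phi> u" using pw by (rule potential_telescope)
  finally have cr: "awalk_cost w r \<le> \<phi> v - \<phi> u" .
  have feas: "\<phi> (head G a) - \<phi> (tail G a) \<le> w a" if "a \<in> arcs G" for a
    using tight[of a] slack[OF that] by fastforce
  have rw: "awalk u r v" using r by (simp add: apath_def)
  have "set r \<subseteq> set p"
  proof
    fix a assume a: "a \<in> set r"
    then have "a \<in> arcs G" using rw by auto
    then show "a \<in> set p"
      using tight_awalk_arcs[OF rw feas cr a] slack[of a] by auto
  qed
  then have "r = p" using apath_subset_eq[OF p r(1)] by simp
  then show ?thesis using r(2) min_cost_le_walk_cost[OF q, of w\<^sub>H] by simp
qed

section \<open>The cycle inequality in symmetric graphs\<close>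

definition symmetrize :: "('a \<times> 'a \<Rightarrow> real) \<Rightarrow> 'a \<Rightarrow> 'a \<Rightarrow> real" where
  "symmetrize w x y = w (x, y) + w (y, x)"

lemma symmetrize_commute: "symmetrize w x y = symmetrize w y x"
  by (simp add: symmetrize_def)

text \<open>Since \<open>w\<close> is symmetric, \<open>\<phi>\<close> certifies the path
  \<open>x0 x1 x2 x3\<close> and its negation certifies the reversed path. The detour through
  \<open>y\<close> competes with both, and adding the two inequalities gives sums over opposite
  arcs, although \<open>w\<^sub>H\<close> itself may be asymmetric.\<close>

lemma preserved_three_arcs:
  fixes G :: "('a, 'a \<times> 'a) pre_digraph" and \<phi> :: "'a \<Rightarrow> real"
  assumes G: "fin_digraph G" "tail G = fst" "head G = snd" "arcs G = E \<union> E\<inverse>"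
    and sym: "\<And>x y. w (x, y) = w (y, x)"
    and wpos: "\<And>a. a \<in> arcs G \<Longrightarrow> w a > 0"
    and spp: "wf_digraph.shortest_paths_preserving G w w\<^sub>H"
    and arcs: "(x0, x1) \<in> arcs G" "(x1, x2) \<in> arcs G" "(x2, x3) \<in> arcs G"
      "(x0, y) \<in> arcs G" "(y, x3) \<in> arcs G"
    and dist: "distinct [x0, x1, x2, x3]"
    and tight: "\<phi> x1 - \<phi> x0 = w (x0, x1)" "\<phi> x2 - \<phi> x1 = w (x1, x2)" "\<phi> x3 - \<phi> x2 = w (x2, x3)"
    and slack: "\<And>a b. (a, b) \<in> E \<Longrightarrow>
      {a, b} \<noteq> {x0, x1} \<Longrightarrow> {a, b} \<noteq> {x1, x2} \<Longrightarrow> {a, b} \<noteq> {x2, x3} \<Longrightarrow> \<bar>\<phi> b - \<phi> a\<bar> < w (a, b)"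
  shows "symmetrize w\<^sub>H x0 x1 + symmetrize w\<^sub>H x1 x2 + symmetrize w\<^sub>H x2 x3
    \<le> symmetrize w\<^sub>H x0 y + symmetrize w\<^sub>H y x3"
proof -
  interpret fin_digraph G by fact
  have symA: "(b, a) \<in> arcs G" if "(a, b) \<in> arcs G" for a b
    using that G(4) by auto
  have verts: "x0 \<in> verts G" "x1 \<in> verts G" "x2 \<in> verts G" "x3 \<in> verts G" "y \<in> verts G"
    using arcs[THEN tail_in_verts] arcs[THEN head_in_verts] G(2,3) by simp_all
  note simps = awalk_simps apath_simps G(2,3) arcs verts symA
  have slackA: "\<bar>\<phi> (snd a) - \<phi> (fst a)\<bar> < w a"
    if "a \<in> arcs G" "a \<notin> {(x0,x1),(x1,x2),(x2,x3)}" "a \<notin> {(x1,x0),(x2,x1),(x3,x2)}" for a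
  proof -
    obtain b c where a: "a = (b, c)" by (cases a)
    have "{b, c} \<noteq> {x0, x1}" "{b, c} \<noteq> {x1, x2}" "{b, c} \<noteq> {x2, x3}"
      using that(2,3) a by (auto simp: doubleton_eq_iff)
    moreover have "(b, c) \<in> E \<or> (c, b) \<in> E" using that(1) a G(4) by auto
    ultimately show ?thesis
      using slack[of b c] slack[of c b] sym[of b c] a
      by (auto simp: insert_commute abs_minus_commute)
  qed
  have pos: "w (x0, x1) > 0" "w (x1, x2) > 0" "w (x2, x3) > 0"
    using arcs wpos by auto
  have "awalk_cost w\<^sub>H [(x0,x1),(x1,x2),(x2,x3)] \<le> awalk_cost w\<^sub>H [(x0,y),(y,x3)]"
  proof (rule preserved_path_cost_le[OF spp, where u = x0 and v = x3 and \<phi> = \<phi>])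
    fix a assume a: "a \<in> arcs G" "a \<notin> set [(x0,x1),(x1,x2),(x2,x3)]"
    show "\<phi> (head G a) - \<phi> (tail G a) < w a"
    \<comment> \<open>On a reversed path arc the potential difference is minus the weight, hence
      below the positive weight.\<close>
    proof (cases "a \<in> {(x1,x0),(x2,x1),(x3,x2)}")
      case True
      then show ?thesis using tight pos sym G(2,3)
        by (auto simp: algebra_simps)
    next
      case False
      then show ?thesis using slackA[of a] a G(2,3) by auto
    qed
  qed (use dist tight in \<open>auto simp: simps\<close>)
  moreover have "awalk_cost w\<^sub>H [(x3,x2),(x2,x1),(x1,x0)] \<le> awalk_cost w\<^sub>H [(x3,y),(y,x0)]"
  proof (rule preserved_path_cost_le[OF spp, where u = x3 and v = x0 and \<phi> = "\<lambda>x. - \<phi> x"])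
    fix a assume a: "a \<in> arcs G" "a \<notin> set [(x3,x2),(x2,x1),(x1,x0)]"
    show "- \<phi> (head G a) - (- \<phi> (tail G a)) < w a"
    proof (cases "a \<in> {(x0,x1),(x1,x2),(x2,x3)}")
      case True
      then show ?thesis using tight pos G(2,3) by auto
    next
      case False
      then show ?thesis using slackA[of a] a G(2,3) by auto
    qed
  qed (use dist tight sym in \<open>auto simp: simps\<close>)
  ultimately show ?thesis by (simp add: symmetrize_def)
qed

section \<open>The ladder graph and its weights\<close>

text \<open>Vertex \<open>3 * k + j\<close> is the \<open>j\<close>-th vertex on level \<open>k\<close>.\<close>

inductive_set ladder :: "nat \<Rightarrow> (nat \<times> nat) set" for m where
  left: "k \<le> m \<Longrightarrow> (3*k, 3*k+1) \<in> ladder m"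
| right: "k \<le> m \<Longrightarrow> (3*k+1, 3*k+2) \<in> ladder m"
| down0: "k < m \<Longrightarrow> (3*k+3, 3*k) \<in> ladder m"
| down1: "k < m \<Longrightarrow> (3*k+4, 3*k+2) \<in> ladder m"
| down2: "k < m \<Longrightarrow> (3*k+5, 3*k) \<in> ladder m"

definition ladder_graph :: "nat \<Rightarrow> (nat, nat \<times> nat) pre_digraph" where
  "ladder_graph m = \<lparr>verts = {..<3*m+3}, arcs = ladder m \<union> (ladder m)\<inverse>, tail = fst, head = snd\<rparr>"

text \<open>Arcs between levels weigh more than any level path below the top, so a shortest path between
  adjacent levels crosses only once.\<close>

definition ladder_weight :: "nat \<Rightarrow> nat \<times> nat \<Rightarrow> real" where
  "ladder_weight m = (\<lambda>(x, y). if x div 3 = y div 3 then 4 ^ (x div 3) else 4 ^ m)"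

lemma ladder_graph_simps [simp]:
  "verts (ladder_graph m) = {..<3*m+3}" "arcs (ladder_graph m) = ladder m \<union> (ladder m)\<inverse>"
  "tail (ladder_graph m) = fst" "head (ladder_graph m) = snd"
  by (simp_all add: ladder_graph_def)

lemma ladder_bounds: "(x, y) \<in> ladder m \<Longrightarrow> x < 3*m+3 \<and> y < 3*m+3 \<and> x \<noteq> y"
  by (cases rule: ladder.cases) auto

lemma digraph_ladder: "digraph (ladder_graph m)"
proof unfold_locales
  have "ladder m \<subseteq> {..<3*m+3} \<times> {..<3*m+3}"
  proof
    fix a assume "a \<in> ladder m"
    then show "a \<in> {..<3*m+3} \<times> {..<3*m+3}"
      using ladder_bounds[of "fst a" "snd a" m] by (cases a) simp
  qed
  then have "finite (ladder m)" by (rule finite_subset) simp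
  then show "finite (arcs (ladder_graph m))" by simp
  fix a assume "a \<in> arcs (ladder_graph m)"
  then obtain x y where "a = (x, y)" "(x, y) \<in> ladder m \<or> (y, x) \<in> ladder m"
    by (cases a) auto
  then show "tail (ladder_graph m) a \<in> verts (ladder_graph m)"
    "head (ladder_graph m) a \<in> verts (ladder_graph m)"
    "tail (ladder_graph m) a \<noteq> head (ladder_graph m) a"
    using ladder_bounds[of x y m] ladder_bounds[of y x m] by auto
qed (auto simp: arc_to_ends_def prod_eq_iff)

lemma ladder_weight_pos: "ladder_weight m a > 0"
  by (auto simp: ladder_weight_def split: prod.split)

lemma ladder_weight_commute: "ladder_weight m (x, y) = ladder_weight m (y, x)"
  by (auto simp: ladder_weight_def)

section \<open>Potentials on the ladder\<close>

text \<open>The potentials certifying shortest paths along level \<open>i\<close>: linear on level \<open>i\<close>, constant below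
  and above levels \<open>i\<close> and \<open>i + 1\<close>.\<close>

definition level_pot :: "nat \<Rightarrow> (nat \<Rightarrow> real) \<Rightarrow> real \<Rightarrow> nat \<Rightarrow> nat \<Rightarrow> real" where
  "level_pot i u t k j = (if k < i then 0 else if k = i then real j * 4 ^ i
     else if k = Suc i then u j else t)"

definition ladder_pot :: "nat \<Rightarrow> (nat \<Rightarrow> real) \<Rightarrow> real \<Rightarrow> nat \<Rightarrow> real" where
  "ladder_pot i u t v = level_pot i u t (v div 3) (v mod 3)"

lemma div_mod_3:
  "Suc (3*k) div 3 = k" "Suc (Suc (3*k)) div 3 = k" "(3*k+3) div 3 = Suc k"
  "(3*k+4) div 3 = Suc k" "(3*k+5) div 3 = Suc k"
  "Suc (3*k) mod 3 = 1" "Suc (Suc (3*k)) mod 3 = 2" "(3*k+3) mod 3 = 0"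
  "(3*k+4) mod 3 = 1" "(3*k+5) mod 3 = 2"
  by presburger+

lemma ladder_pot_simps [simp]:
  "ladder_pot i u t (3*k) = level_pot i u t k 0"
  "ladder_pot i u t (Suc (3*k)) = level_pot i u t k 1"
  "ladder_pot i u t (Suc (Suc (3*k))) = level_pot i u t k 2"
  "ladder_pot i u t (3*k+3) = level_pot i u t (Suc k) 0"
  "ladder_pot i u t (3*k+4) = level_pot i u t (Suc k) 1"
  "ladder_pot i u t (3*k+5) = level_pot i u t (Suc k) 2"
  by (simp_all only: ladder_pot_def div_mod_3) simp_all

lemma ladder_weight_simps [simp]:
  "ladder_weight m (3*k, Suc (3*k)) = 4 ^ k"
  "ladder_weight m (Suc (3*k), Suc (Suc (3*k))) = 4 ^ k"
  "ladder_weight m (3*k+3, 3*k) = 4 ^ m"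
  "ladder_weight m (3*k+4, Suc (Suc (3*k))) = 4 ^ m"
  "ladder_weight m (3*k+5, 3*k) = 4 ^ m"
  "ladder_weight m (Suc (Suc (3*k)), 3*k+4) = 4 ^ m"
  by (simp_all add: ladder_weight_def div_mod_3)

lemma four_power_gap:
  assumes "i < m"
  shows "(4::real) ^ i < 4 ^ m" "2 * (4::real) ^ i < 4 ^ m" "3 * (4::real) ^ i < 4 ^ m"
    "4 * (4::real) ^ i \<le> 4 ^ m"
proof -
  show *: "4 * (4::real) ^ i \<le> 4 ^ m"
    using assms power_increasing[of "Suc i" m "4::real"] by simp
  have "(0::real) < 4 ^ i" by simp
  with * show "(4::real) ^ i < 4 ^ m" "2 * (4::real) ^ i < 4 ^ m" "3 * (4::real) ^ i < 4 ^ m"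
    by linarith+
qed

text \<open>The excluded arcs are those on level \<open>i\<close> and between levels
  \<open>i\<close> and \<open>i + 1\<close>. Elsewhere the potential varies within a level only on
  level \<open>i + 1\<close>, by less than the weight \<open>4 ^ (i + 1)\<close>. Between levels it
  jumps by at most \<open>2 * 4 ^ i\<close> just below level \<open>i\<close>, by some
  \<open>u j - t\<close> just above level \<open>i + 1\<close>, and otherwise not at all.\<close>

lemma ladder_pot_slack:
  assumes "(a, b) \<in> ladder m" and i: "i < m"
    and u: "\<bar>u 1 - u 0\<bar> < 4 * 4 ^ i" "\<bar>u 2 - u 1\<bar> < 4 * 4 ^ i"
    and t: "\<bar>u 0 - t\<bar> < 4 ^ m" "\<bar>u 1 - t\<bar> < 4 ^ m" "\<bar>u 2 - t\<bar> < 4 ^ m"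
    and off: "(a, b) \<notin> {(3*i, 3*i+1), (3*i+1, 3*i+2), (3*i+3, 3*i), (3*i+4, 3*i+2), (3*i+5, 3*i)}"
  shows "\<bar>ladder_pot i u t b - ladder_pot i u t a\<bar> < ladder_weight m (a, b)"
proof -
  note H = four_power_gap[OF i]
  have side: "\<bar>level_pot i u t k 1 - level_pot i u t k 0\<bar> < 4 ^ k"
    "\<bar>level_pot i u t k 2 - level_pot i u t k 1\<bar> < 4 ^ k" if "k \<noteq> i" for k
    using that u by (simp_all add: level_pot_def)
  have down: "\<bar>level_pot i u t k 0 - level_pot i u t (Suc k) 0\<bar> < 4 ^ m"
    "\<bar>level_pot i u t k 2 - level_pot i u t (Suc k) 1\<bar> < 4 ^ m"
    "\<bar>level_pot i u t k 0 - level_pot i u t (Suc k) 2\<bar> < 4 ^ m" if k: "k \<noteq> i" for k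
  proof -
    consider "Suc k < i" | "Suc k = i" | "k = Suc i" | "k > Suc i"
      using k by linarith
    then have "\<bar>level_pot i u t k 0 - level_pot i u t (Suc k) 0\<bar> < 4 ^ m
      \<and> \<bar>level_pot i u t k 2 - level_pot i u t (Suc k) 1\<bar> < 4 ^ m
      \<and> \<bar>level_pot i u t k 0 - level_pot i u t (Suc k) 2\<bar> < 4 ^ m"
      by cases (use t H in \<open>simp_all add: level_pot_def\<close>)
    then show "\<bar>level_pot i u t k 0 - level_pot i u t (Suc k) 0\<bar> < 4 ^ m"
      "\<bar>level_pot i u t k 2 - level_pot i u t (Suc k) 1\<bar> < 4 ^ m"
      "\<bar>level_pot i u t k 0 - level_pot i u t (Suc k) 2\<bar> < 4 ^ m" by auto
  qed
  from assms(1) show ?thesis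
  proof cases
    case (left k)
    then show ?thesis using off side(1)[of k] by auto
  next
    case (right k)
    then show ?thesis using off side(2)[of k] by auto
  next
    case (down0 k)
    then show ?thesis using off down(1)[of k] by auto
  next
    case (down1 k)
    then show ?thesis using off down(2)[of k] by auto
  next
    case (down2 k)
    then show ?thesis using off down(3)[of k] by auto
  qed
qed

section \<open>Doubling from level to level\<close>

context
  fixes m :: nat and w\<^sub>H :: "nat \<times> nat \<Rightarrow> real"
  assumes spp: "wf_digraph.shortest_paths_preserving (ladder_graph m) (ladder_weight m) w\<^sub>H"
begin

text \<open>By \<open>ladder_pot_slack\<close>, a certificate needs checking by hand only on the
  five arcs listed in \<open>near\<close>.\<close>

lemma ladder_preserved:
  assumes "i < m"
    and "(x0, x1) \<in> arcs (ladder_graph m)" "(x1, x2) \<in> arcs (ladder_graph m)"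
      "(x2, x3) \<in> arcs (ladder_graph m)"
      "(x0, y) \<in> arcs (ladder_graph m)" "(y, x3) \<in> arcs (ladder_graph m)"
    and "distinct [x0, x1, x2, x3]"
    and "\<phi> x1 - \<phi> x0 = ladder_weight m (x0, x1)"
      "\<phi> x2 - \<phi> x1 = ladder_weight m (x1, x2)" "\<phi> x3 - \<phi> x2 = ladder_weight m (x2, x3)"
    and \<phi>: "\<phi> = ladder_pot i u t"
    and u: "\<bar>u 1 - u 0\<bar> < 4 * 4 ^ i" "\<bar>u 2 - u 1\<bar> < 4 * 4 ^ i"
    and t: "\<bar>u 0 - t\<bar> < 4 ^ m" "\<bar>u 1 - t\<bar> < 4 ^ m" "\<bar>u 2 - t\<bar> < 4 ^ m"
    and near: "\<And>a b. (a, b) \<in> {(3*i, 3*i+1), (3*i+1, 3*i+2), (3*i+3, 3*i), (3*i+4, 3*i+2), (3*i+5, 3*i)}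
      \<Longrightarrow> {a, b} \<noteq> {x0, x1} \<Longrightarrow> {a, b} \<noteq> {x1, x2} \<Longrightarrow> {a, b} \<noteq> {x2, x3}
      \<Longrightarrow> \<bar>\<phi> b - \<phi> a\<bar> < ladder_weight m (a, b)"
  shows "symmetrize w\<^sub>H x0 x1 + symmetrize w\<^sub>H x1 x2 + symmetrize w\<^sub>H x2 x3
    \<le> symmetrize w\<^sub>H x0 y + symmetrize w\<^sub>H y x3"
proof (rule preserved_three_arcs[OF _ _ _ _ _ _ spp assms(2-10), where E = "ladder m"])
  show "fin_digraph (ladder_graph m)"
    using digraph_ladder by (simp add: digraph_def)
  fix a b assume ab: "(a, b) \<in> ladder m" and n: "{a, b} \<noteq> {x0, x1}" "{a, b} \<noteq> {x1, x2}" "{a, b} \<noteq> {x2, x3}"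
  show "\<bar>\<phi> b - \<phi> a\<bar> < ladder_weight m (a, b)"
  proof (cases "(a, b) \<in> {(3*i, 3*i+1), (3*i+1, 3*i+2), (3*i+3, 3*i), (3*i+4, 3*i+2), (3*i+5, 3*i)}")
    case True
    then show ?thesis by (rule near[OF _ n])
  next
    case False
    show ?thesis unfolding \<phi> by (rule ladder_pot_slack[OF ab assms(1) u t False])
  qed
qed (auto simp: ladder_weight_pos ladder_weight_commute)

definition "side k = symmetrize w\<^sub>H (3*k) (3*k+1) + symmetrize w\<^sub>H (3*k+1) (3*k+2)" for k

text \<open>With \<open>a b c\<close> for the vertices of a level, the arcs down from level
  \<open>i + 1\<close> join \<open>a\<close> and \<open>c\<close> to the lower \<open>a\<close>, and
  \<open>b\<close> to the lower \<open>c\<close>. So each upper arc \<open>ab\<close> and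
  \<open>cb\<close> closes a 5-cycle with the path on level \<open>i\<close>. Each cycle gives two
  inequalities, one for each of the two three-arc paths that extend the level path by an arc between
  levels.\<close>

lemma
  assumes i: "i < m"
  shows down0_side_le: "symmetrize w\<^sub>H (3*i+3) (3*i) + side i
    \<le> symmetrize w\<^sub>H (3*i+3) (3*i+4) + symmetrize w\<^sub>H (3*i+4) (3*i+2)" (is ?A)
  and down2_side_le: "symmetrize w\<^sub>H (3*i+5) (3*i) + side i
    \<le> symmetrize w\<^sub>H (3*i+5) (3*i+4) + symmetrize w\<^sub>H (3*i+4) (3*i+2)" (is ?B)
  and side_down1_le0: "side i + symmetrize w\<^sub>H (3*i+2) (3*i+4)
    \<le> symmetrize w\<^sub>H (3*i) (3*i+3) + symmetrize w\<^sub>H (3*i+3) (3*i+4)" (is ?C)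
  and side_down1_le2: "side i + symmetrize w\<^sub>H (3*i+2) (3*i+4)
    \<le> symmetrize w\<^sub>H (3*i) (3*i+5) + symmetrize w\<^sub>H (3*i+5) (3*i+4)" (is ?D)
proof -
  note H = four_power_gap[OF i]
  have arcs: "(3*i, 3*i+1) \<in> ladder m" "(3*i+1, 3*i+2) \<in> ladder m" "(3*i+3, 3*i) \<in> ladder m"
    "(3*i+4, 3*i+2) \<in> ladder m" "(3*i+5, 3*i) \<in> ladder m"
    "(3*i+3, 3*i+4) \<in> ladder m" "(3*i+4, 3*i+5) \<in> ladder m"
    using i ladder.intros[of i m] ladder.left[of "Suc i" m] ladder.right[of "Suc i" m]
    by (simp_all add: numeral_eq_Suc)
  note simps = level_pot_def doubleton_eq_iff
  \<comment> \<open>The value \<open>- (4 ^ m)\<close> at the upper starting vertex makes the arc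
    down tight. The offset \<open>3 * 4 ^ i\<close> of the other upper vertices exceeds
    \<open>2 * 4 ^ i\<close>, which gives slack on the arc from the upper \<open>b\<close> to the
    lower \<open>c\<close>, and stays below the weight \<open>4 ^ (i + 1)\<close> of an upper level
    arc.\<close>
  have ?A
    unfolding side_def add.assoc[symmetric]
    by (rule ladder_preserved[OF i, where t = "- (4 ^ m)"
          and u = "\<lambda>j. if j = 0 then - (4 ^ m) else 3 * 4 ^ i - 4 ^ m", OF _ _ _ _ _ _ _ _ _ refl])
       (use arcs H in \<open>auto simp: simps\<close>)
  have ?B
    unfolding side_def add.assoc[symmetric]
    by (rule ladder_preserved[OF i, where t = "- (4 ^ m)"
          and u = "\<lambda>j. if j = 2 then - (4 ^ m) else 3 * 4 ^ i - 4 ^ m", OF _ _ _ _ _ _ _ _ _ refl])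
       (use arcs H in \<open>auto simp: simps\<close>)
  \<comment> \<open>Now the upper \<open>b\<close> is the tight end of the path, and the other two
    upper vertices lie \<open>3 * 4 ^ i\<close> below it. The same path and potential serve
    \<open>?D\<close>; only the detour differs.\<close>
  have ?C
    unfolding side_def
    by (rule ladder_preserved[OF i, where t = "4 ^ m"
          and u = "\<lambda>j. if j = 1 then 2 * 4 ^ i + 4 ^ m else 4 ^ m - 4 ^ i", OF _ _ _ _ _ _ _ _ _ refl])
       (use arcs H in \<open>auto simp: simps\<close>)
  have ?D
    unfolding side_def
    by (rule ladder_preserved[OF i, where t = "4 ^ m"
          and u = "\<lambda>j. if j = 1 then 2 * 4 ^ i + 4 ^ m else 4 ^ m - 4 ^ i", OF _ _ _ _ _ _ _ _ _ refl])
       (use arcs H in \<open>auto simp: simps\<close>)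
  show ?A ?B ?C ?D by fact+
qed

text \<open>Adding \<open>down0_side_le\<close> and \<open>side_down1_le0\<close> cancels the arcs
  between levels and bounds \<open>side i\<close> by the upper arc \<open>ab\<close>; the other two
  inequalities bound it by \<open>cb\<close>.\<close>

lemma side_double: "i < m \<Longrightarrow> 2 * side i \<le> side (Suc i)"
  using down0_side_le[of i] down2_side_le[of i] side_down1_le0[of i] side_down1_le2[of i]
    symmetrize_commute[of w\<^sub>H "3*i" "3*i+3"] symmetrize_commute[of w\<^sub>H "3*i" "3*i+5"]
    symmetrize_commute[of w\<^sub>H "3*i+2" "3*i+4"] symmetrize_commute[of w\<^sub>H "3*i+5" "3*i+4"]
  by (simp add: side_def[of "Suc i"] add.commute)

lemma side_power: "i \<le> m \<Longrightarrow> 2 ^ i * side 0 \<le> side i"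
proof (induction i)
  case (Suc i)
  then show ?case using side_double[of i] by simp
qed simp

text \<open>Each \<open>side\<close> sums four arc weights, so the bottom one is at least four times
  the minimum and the top one at most four times the maximum.\<close>

lemma ladder_aspect_ratio: "wf_digraph.aspect_ratio (ladder_graph m) w\<^sub>H \<ge> 2 ^ m"
proof -
  interpret digraph "ladder_graph m" by (rule digraph_ladder)
  define S where "S = w\<^sub>H ` arcs (ladder_graph m)"
  have fin: "finite S" unfolding S_def by (rule finite_imageI) (rule finite_arcs)
  have mem: "w\<^sub>H (x, y) \<in> S \<and> w\<^sub>H (y, x) \<in> S" if "(x, y) \<in> ladder m" for x y
    using that by (auto simp: S_def)
  have ne: "S \<noteq> {}" using mem[OF ladder.left[of 0]] by auto
  have sym: "2 * Min S \<le> symmetrize w\<^sub>H x y \<and> symmetrize w\<^sub>H x y \<le> 2 * Max S"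
    if "(x, y) \<in> ladder m" for x y
    using mem[OF that] Min_le[OF fin] Max_ge[OF fin] by (smt (verit) symmetrize_def)
  have "Min S \<in> S" using fin ne by simp
  then have pos: "Min S > 0"
    using spp unfolding S_def shortest_paths_preserving_def positive_weights_def by auto
  have "4 * Min S \<le> side 0"
    using sym[OF ladder.left[of 0]] sym[OF ladder.right[of 0]] by (simp add: side_def)
  then have "2 ^ m * (4 * Min S) \<le> 2 ^ m * side 0" by simp
  also have "\<dots> \<le> side m" by (rule side_power) simp
  also have "\<dots> \<le> 4 * Max S"
    using sym[OF ladder.left[of m]] sym[OF ladder.right[of m]] by (simp add: side_def)
  finally show ?thesis
    using pos unfolding aspect_ratio_def S_def[symmetric] by (simp add: field_simps)
qed

end

theorem theorem1p4:
  shows "\<exists>c::real. c > 0 \<and>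
    (\<exists>\<^sub>\<infinity>n::nat. \<exists>(G :: (nat, nat \<times> nat) pre_digraph) (w :: (nat \<times> nat) weight_fun).
       digraph G \<and> card (verts G) = n \<and> arcs G \<noteq> {} \<and>
       wf_digraph.positive_weights G w \<and>
       (\<forall>w\<^sub>H. wf_digraph.shortest_paths_preserving G w w\<^sub>H \<longrightarrow>
          wf_digraph.aspect_ratio G w\<^sub>H \<ge> 2 powr (c * real n)))"
proof (intro exI[of _ "1/6"] conjI)
  show "\<exists>\<^sub>\<infinity>n::nat. \<exists>(G :: (nat, nat \<times> nat) pre_digraph) (w :: (nat \<times> nat) weight_fun).
       digraph G \<and> card (verts G) = n \<and> arcs G \<noteq> {} \<and>
       wf_digraph.positive_weights G w \<and>
       (\<forall>w\<^sub>H. wf_digraph.shortest_paths_preserving G w w\<^sub>H \<longrightarrow>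
          wf_digraph.aspect_ratio G w\<^sub>H \<ge> 2 powr (1/6 * real n))"
    unfolding INFM_nat
  proof (intro allI exI conjI impI)
    fix N :: nat
    \<comment> \<open>Starting at \<open>?m \<ge> 1\<close> ensures that the number
      \<open>3 * ?m + 3\<close> of vertices is at most \<open>6 * ?m\<close>, which gives the
      constant \<open>1/6\<close>.\<close>
    let ?m = "Suc N" and ?G = "ladder_graph (Suc N)"
    show "N < 3 * ?m + 3" by simp
    show "digraph ?G" by (rule digraph_ladder)
    then interpret digraph ?G .
    show "card (verts ?G) = 3 * ?m + 3" by simp
    show "arcs ?G \<noteq> {}" using ladder.left[of 0 ?m] by auto
    show "positive_weights (ladder_weight ?m)"
      by (simp add: positive_weights_def ladder_weight_pos)
    fix w\<^sub>H assume "shortest_paths_preserving (ladder_weight ?m) w\<^sub>H"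
    then have "2 ^ ?m \<le> aspect_ratio w\<^sub>H" by (rule ladder_aspect_ratio)
    moreover have "2 powr (1/6 * real (3 * ?m + 3)) \<le> 2 powr real ?m"
      by (intro powr_mono) auto
    ultimately show "2 powr (1/6 * real (3 * ?m + 3)) \<le> aspect_ratio w\<^sub>H"
      by (simp only: powr_realpow)
  qed
qed simp

end
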